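(* Let $W$ be a real Hilbert space with a closed-nilpotent operator $\mathrm{d}$ defined on the dense domain $V\subset W$. Suppose that $V_h\subset V$ is a family of closed subspaces (closed in $V$), parametrized by $h$, satisfying $\mathrm{d}V_h\subset V_h$. Suppose also that these subspaces are equipped with projections $\pi_h\colon V\to V_h$, bounded uniformly in $h$, such that $\pi_h\mathrm{d}=\mathrm{d}\pi_h$. Then there is a constant $C>0$, independent of $h$ and $f$, such that the following holds for every $f\in W$ and every $h$. If $(\sigma,u,p)\in V\times V\times\mathfrak{H}$ solves $$\begin{aligned}\langle\sigma,\tau\rangle-\langle u,\mathrm{d}\tau\rangle&=0,&&\forall\tau\in V,\\ \langle\mathrm{d}\sigma,v\rangle+\langle\mathrm{d}u,\mathrm{d}v\rangle+\langle p,v\rangle&=\langle f,v\rangle,&&\forall v\in V,\\ \langle u,q\rangle&=0,&&\forall q\in\mathfrak{H},\end{aligned}$$ and $(\sigma_h,u_h,p_h)\in V_h\times V_h\times\mathfrak{H}_h$ solves $$\begin{aligned}\langle\sigma_h,\tau_h\rangle-\langle u_h,\mathrm{d}\tau_h\rangle&=0,&&\forall\tau_h\in V_h,\\ \langle\mathrm{d}\sigma_h,v_h\rangle+\langle\mathrm{d}u_h,\mathrm{d}v_h\rangle+\langle p_h,v_h\rangle&=\langle f,v_h\rangle,&&\forall v_h\in V_h,\\ \langle u_h,q_h\rangle&=0,&&\forall q_h\in\mathfrak{H}_h,\end{aligned}$$ then $$\|\sigma-\sigma_h\|_V+\|u-u_h\|_V+\|p-p_h\|\le C\Bigl(\inf_{\tau\in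 V_h}\|\sigma-\tau\|_V+\inf_{v\in V_h}\|u-v\|_V+\inf_{q\in V_h}\|p-q\|_V+\mu\inf_{v\in V_h}\|P_{\mathfrak{B}}u-v\|_V\Bigr),$$ where $\mu=\|(I-\pi_h)P_{\mathfrak{H}}\|$.
   Context: $W$ has inner product $\langle\cdot,\cdot\rangle$ and norm $\|\cdot\|$. A closed, densely defined linear operator $\mathrm{d}$ on $W$ with domain $V=\mathcal{D}(\mathrm{d})$ is nilpotent if its range is contained in its kernel (so $\mathrm{d}^2=0$), and closed-nilpotent if in addition its range is closed. $V$ carries the graph inner product $\langle u,v\rangle_V=\langle u,v\rangle+\langle \mathrm{d}u,\mathrm{d}v\rangle$ with norm $\|\cdot\|_V$. Set $\mathfrak{Z}=\ker\mathrm{d}$, $\mathfrak{B}=\operatorname{range}\mathrm{d}$, $\mathfrak{H}=\mathfrak{Z}\cap\mathfrak{B}^{\perp_W}$, where $\perp_W$ is the orthogonal complement in $W$. $P_{\mathfrak{B}}$ and $P_{\mathfrak{H}}$ are the $W$-orthogonal projections onto $\mathfrak{B}$ and $\mathfrak{H}$. "Projection $\pi_h$" means linear, idempotent and surjective onto $V_h$ (not necessarily orthogonal); boundedness of $\pi_h$ is with respect to $\|\cdot\|_V$. The quantity $\mu$ (which depends on $h$) is the operator norm of $(I-\pi_h)P_{\mathfrak{H}}$ as an operator on $W$. For the restriction $\mathrm{d}_h=\mathrm{d}|_{V_h}$ put $\mathfrak{Z}_h=\ker\mathrm{d}_h$, $\mathfrak{B}_h=\mathrm{d}V_h$, and $\mathfrak{H}_h=\{z\in\mathfrak{Z}_h:\langle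 z,b\rangle=0\ \forall b\in\mathfrak{B}_h\}$. *)

theory Defs
  imports "HOL-Analysis.Analysis"
begin

text \<open>An unbounded operator is a total function \<open>d\<close> together with its domain \<open>V\<close>; the values of \<open>d\<close>
  outside \<open>V\<close> are never used.\<close>

definition lin_on :: "'a::real_vector set \<Rightarrow> ('a \<Rightarrow> 'b::real_vector) \<Rightarrow> bool" where
  "lin_on V f \<longleftrightarrow> subspace V
     \<and> (\<forall>x\<in>V. \<forall>y\<in>V. f (x + y) = f x + f y)
     \<and> (\<forall>c. \<forall>x\<in>V. f (c *\<^sub>R x) = c *\<^sub>R f x)"

definition ker_on :: "'a set \<Rightarrow> ('a \<Rightarrow> 'b::zero) \<Rightarrow> 'a set" where
  "ker_on V d = {v \<in> V. d v = 0}"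

definition closed_op :: "'a::real_normed_vector set \<Rightarrow> ('a \<Rightarrow> 'b::real_normed_vector) \<Rightarrow> bool" where
  "closed_op V d \<longleftrightarrow> lin_on V d \<and> closed ((\<lambda>v. (v, d v)) ` V)"

definition nilpotent_op :: "'a::real_normed_vector set \<Rightarrow> ('a \<Rightarrow> 'a) \<Rightarrow> bool" where
  "nilpotent_op V d \<longleftrightarrow> closed_op V d \<and> closure V = UNIV \<and> d ` V \<subseteq> ker_on V d"

definition closed_nilpotent_op :: "'a::real_normed_vector set \<Rightarrow> ('a \<Rightarrow> 'a) \<Rightarrow> bool" where
  "closed_nilpotent_op V d \<longleftrightarrow> nilpotent_op V d \<and> closed (d ` V)"

definition graph_inner :: "('a::real_inner \<Rightarrow> 'a) \<Rightarrow> 'a \<Rightarrow> 'a \<Rightarrow> real" where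
  "graph_inner d u v = u \<bullet> v + d u \<bullet> d v"

definition graph_norm :: "('a::real_inner \<Rightarrow> 'a) \<Rightarrow> 'a \<Rightarrow> real" where
  "graph_norm d v = sqrt (graph_inner d v v)"

text \<open>\<open>S\<close> is a linear subspace of \<open>V\<close>, closed with respect to the graph norm (but in general not
  closed in the ambient Hilbert space).\<close>

definition graph_closed_subspace ::
    "'a::real_inner set \<Rightarrow> ('a \<Rightarrow> 'a) \<Rightarrow> 'a set \<Rightarrow> bool" where
  "graph_closed_subspace V d S \<longleftrightarrow> subspace S \<and> S \<subseteq> V
     \<and> (\<forall>s. \<forall>v\<in>V. (\<forall>n. s n \<in> S) \<and> (\<lambda>n. graph_norm d (s n - v)) \<longlonglongrightarrow> 0 \<longrightarrow> v \<in> S)"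

text \<open>The harmonic space. It is used both with \<open>V\<close> itself and with a subspace \<open>V\<^sub>h\<close> in place of \<open>V\<close>
  (that is, for the restriction of \<open>d\<close> to \<open>V\<^sub>h\<close>); the orthogonal complement is taken in the whole
  Hilbert space in both cases.\<close>

definition harmonic :: "'a::real_inner set \<Rightarrow> ('a \<Rightarrow> 'a) \<Rightarrow> 'a set" where
  "harmonic V d = ker_on V d \<inter> (d ` V)\<^sup>\<bottom>"

text \<open>The orthogonal projection onto \<open>S\<close>; meaningful when \<open>S\<close> is a closed subspace of a
  Hilbert space.\<close>

definition orth_proj :: "'a::real_inner set \<Rightarrow> 'a \<Rightarrow> 'a" where
  "orth_proj S x = (THE y. y \<in> S \<and> x - y \<in> S\<^sup>\<bottom>)"

definition projection_onto :: "'a::real_vector set \<Rightarrow> 'a set \<Rightarrow> ('a \<Rightarrow> 'a) \<Rightarrow> bool" where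
  "projection_onto V S p \<longleftrightarrow> lin_on V p \<and> p ` V = S \<and> (\<forall>v\<in>V. p (p v) = p v)"

text \<open>The mixed formulation of the abstract Hodge Laplace problem, posed on \<open>V\<close>; the discrete problem
  is the same one posed on a subspace \<open>V\<^sub>h\<close>.\<close>

definition mixed_solution ::
    "'a::real_inner set \<Rightarrow> ('a \<Rightarrow> 'a) \<Rightarrow> 'a \<Rightarrow> 'a \<Rightarrow> 'a \<Rightarrow> 'a \<Rightarrow> bool" where
  "mixed_solution V d f \<sigma> u p \<longleftrightarrow>
     \<sigma> \<in> V \<and> u \<in> V \<and> p \<in> harmonic V d
     \<and> (\<forall>\<tau>\<in>V. \<sigma> \<bullet> \<tau> - u \<bullet> d \<tau> = 0)
     \<and> (\<forall>v\<in>V. d \<sigma> \<bullet> v + d u \<bullet> d v + p \<bullet> v = f \<bullet> v)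
     \<and> (\<forall>q\<in>harmonic V d. u \<bullet> q = 0)"

definition best_error :: "('a::real_inner \<Rightarrow> 'a) \<Rightarrow> 'a set \<Rightarrow> 'a \<Rightarrow> real" where
  "best_error d S x = (INF y\<in>S. graph_norm d (x - y))"

end

theory Submission
  imports Defs
begin

text \<open>On the discrete level \<open>\<pi>\<^sub>h\<close> turns a bounded right inverse of \<open>d\<close> (open mapping theorem) into a
  Poincare inequality on \<open>V\<^sub>h\<close> with a constant independent of \<open>h\<close>. Together with the discrete Hodge
  decomposition this makes the discrete mixed problem stable, uniformly in \<open>h\<close>. The exact solution
  satisfies the discrete equations except for \<open>\<langle>u, q\<rangle> = 0\<close> with discrete harmonic \<open>q\<close>. Since \<open>u\<close> is
  orthogonal to \<open>\<HH>\<close>, this defect is \<open>\<langle>(I - \<pi>\<^sub>h) P\<^sub>\<BB> u, (I - P\<^sub>\<HH>) q\<rangle>\<close>, and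
  \<open>\<parallel>(I - P\<^sub>\<HH>) q\<parallel> \<le> \<parallel>(I - \<pi>\<^sub>h) P\<^sub>\<HH> q\<parallel> \<le> \<mu> \<parallel>q\<parallel>\<close> because \<open>(I - P\<^sub>\<HH>) q\<close> is orthogonal
  to \<open>q - \<pi>\<^sub>h P\<^sub>\<HH> q \<in> \<BB>\<^sub>h\<close>.\<close>

subsection \<open>Orthogonal projections\<close>

lemma orthogonal_comp_iff: "x \<in> S\<^sup>\<bottom> \<longleftrightarrow> (\<forall>y\<in>S. x \<bullet> y = 0)"
  by (auto simp: orthogonal_comp_def orthogonal_def inner_commute)

lemma closed_orthogonal_comp:
  fixes S :: "'a::real_inner set"
  shows "closed (S\<^sup>\<bottom>)"
proof -
  have "S\<^sup>\<bottom> = (\<Inter>y\<in>S. {x. y \<bullet> x = 0})"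
    by (auto simp: orthogonal_comp_def orthogonal_def)
  then show ?thesis by (simp add: closed_INT closed_hyperplane)
qed

lemma closest_point_orthogonal:
  fixes S :: "'a::real_inner set"
  assumes "subspace S" and "y \<in> S" and min: "\<And>z. z \<in> S \<Longrightarrow> norm (x - y) \<le> norm (x - z)"
  shows "x - y \<in> S\<^sup>\<bottom>"
  unfolding orthogonal_comp_iff
proof
  fix z assume z: "z \<in> S"
  define t where "t = ((x - y) \<bullet> z) / (z \<bullet> z)"
  show "(x - y) \<bullet> z = 0"
  proof (cases "z = 0")
    case False
    then have zz: "z \<bullet> z > 0" by simp
    have "y + t *\<^sub>R z \<in> S" using assms z by (simp add: subspace_add subspace_scale)
    from min[OF this] have "(norm (x - y))\<^sup>2 \<le> (norm ((x - y) - t *\<^sub>R z))\<^sup>2"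
      by (intro power_mono) (auto simp: algebra_simps)
    then have "0 \<le> t * t * (z \<bullet> z) - 2 * t * ((x - y) \<bullet> z)"
      unfolding power2_norm_eq_inner
      by (simp add: inner_diff_left inner_diff_right inner_commute algebra_simps)
    also have "\<dots> = - (((x - y) \<bullet> z)\<^sup>2 / (z \<bullet> z))"
      using zz unfolding t_def by (simp add: field_simps power2_eq_square)
    finally have "((x - y) \<bullet> z)\<^sup>2 / (z \<bullet> z) \<le> 0" by simp
    then have "((x - y) \<bullet> z)\<^sup>2 \<le> 0" unfolding pos_divide_le_eq[OF zz] by simp
    then show ?thesis by simp
  qed simp
qed

lemma closed_subspace_closest_point:
  fixes S :: "'a::{real_inner, complete_space} set"
  assumes S: "subspace S" "closed S"
  obtains y where "y \<in> S" "\<And>z. z \<in> S \<Longrightarrow> norm (x - y) \<le> norm (x - z)"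
proof -
  define \<delta> where "\<delta> = (INF z\<in>S. norm (x - z))"
  have ne: "S \<noteq> {}" using S(1) subspace_0 by blast
  have bdd: "bdd_below ((\<lambda>z. norm (x - z)) ` S)" by (auto intro!: bdd_belowI[of _ 0])
  have low: "\<delta> \<le> norm (x - z)" if "z \<in> S" for z
    unfolding \<delta>_def using bdd that by (rule cINF_lower)
  have \<delta>0: "0 \<le> \<delta>" unfolding \<delta>_def using ne by (intro cINF_greatest) auto
  have "\<exists>z\<in>S. norm (x - z) < \<delta> + 1 / Suc n" for n
    using cINF_less_iff[OF ne bdd, of "\<delta> + 1 / Suc n"] by (simp add: \<delta>_def)
  then obtain s where s: "\<And>n. s n \<in> S" and sn: "\<And>n. norm (x - s n) < \<delta> + 1 / Suc n" by metis
  have par: "(norm (s m - s n))\<^sup>2 \<le> 2 * (norm (x - s m))\<^sup>2 + 2 * (norm (x - s n))\<^sup>2 - 4 * \<delta>\<^sup>2" for m n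
  proof -
    have "(1/2) *\<^sub>R (s m + s n) \<in> S" using s S(1) by (simp add: subspace_add subspace_scale)
    from low[OF this] have "\<delta>\<^sup>2 \<le> (norm (x - (1/2) *\<^sub>R (s m + s n)))\<^sup>2"
      using \<delta>0 by (intro power_mono)
    moreover have "(norm (s m - s n))\<^sup>2
        = 2 * (norm (x - s m))\<^sup>2 + 2 * (norm (x - s n))\<^sup>2 - 4 * (norm (x - (1/2) *\<^sub>R (s m + s n)))\<^sup>2"
      unfolding power2_norm_eq_inner
      by (simp add: inner_diff_left inner_diff_right inner_add_left inner_add_right
          inner_commute algebra_simps)
    ultimately show ?thesis by linarith
  qed
  have lim1: "(\<lambda>n. norm (x - s n)) \<longlonglongrightarrow> \<delta>"
  proof (rule real_tendsto_sandwich)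
    show "\<forall>\<^sub>F n in sequentially. \<delta> \<le> norm (x - s n)" using low s by simp
    show "\<forall>\<^sub>F n in sequentially. norm (x - s n) \<le> \<delta> + 1 / Suc n" using sn by (simp add: less_imp_le)
    show "(\<lambda>n. \<delta> + 1 / Suc n) \<longlonglongrightarrow> \<delta>"
      using tendsto_add[OF tendsto_const LIMSEQ_inverse_real_of_nat, of \<delta>]
      by (simp add: inverse_eq_divide)
  qed simp
  have "Cauchy s"
  proof (rule metric_CauchyI)
    fix e :: real assume e: "0 < e"
    have "(\<lambda>n. 2 * (norm (x - s n))\<^sup>2) \<longlonglongrightarrow> 2 * \<delta>\<^sup>2" by (intro tendsto_intros lim1)
    then have "\<forall>\<^sub>F n in sequentially. 2 * (norm (x - s n))\<^sup>2 < 2 * \<delta>\<^sup>2 + e\<^sup>2 / 2"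
      by (rule order_tendstoD(2)) (use e in simp)
    then obtain N where N: "\<And>n. n \<ge> N \<Longrightarrow> 2 * (norm (x - s n))\<^sup>2 < 2 * \<delta>\<^sup>2 + e\<^sup>2 / 2"
      by (auto simp: eventually_sequentially)
    have "dist (s m) (s n) < e" if "m \<ge> N" "n \<ge> N" for m n
    proof -
      have "(norm (s m - s n))\<^sup>2 < e\<^sup>2" using par[of m n] N[OF that(1)] N[OF that(2)] by linarith
      from power2_less_imp_less[OF this] e show ?thesis by (simp add: dist_norm)
    qed
    then show "\<exists>M. \<forall>m\<ge>M. \<forall>n\<ge>M. dist (s m) (s n) < e" by blast
  qed
  then obtain y where y: "s \<longlonglongrightarrow> y" using Cauchy_convergent convergent_def by blast
  have yS: "y \<in> S" using S(2) s y closed_sequentially by blast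
  have "(\<lambda>n. norm (x - s n)) \<longlonglongrightarrow> norm (x - y)" by (intro tendsto_intros y)
  with lim1 have "norm (x - y) = \<delta>" using LIMSEQ_unique by blast
  then show thesis using that yS low by metis
qed

lemma orthogonal_decomposition:
  fixes S :: "'a::{real_inner, complete_space} set"
  assumes "subspace S" "closed S"
  obtains y where "y \<in> S" "x - y \<in> S\<^sup>\<bottom>"
  using closed_subspace_closest_point[OF assms] closest_point_orthogonal[OF assms(1)] by metis

lemma orth_proj_eqI:
  assumes "subspace S" "y \<in> S" "x - y \<in> S\<^sup>\<bottom>"
  shows "orth_proj S x = y"
  unfolding orth_proj_def
proof (rule the_equality)
  fix z assume z: "z \<in> S \<and> x - z \<in> S\<^sup>\<bottom>"
  then have "z - y \<in> S" using assms subspace_diff by blast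
  then have "(x - y) \<bullet> (z - y) = 0" "(x - z) \<bullet> (z - y) = 0"
    using z assms by (auto simp: orthogonal_comp_iff)
  then have "(z - y) \<bullet> (z - y) = 0" by (simp add: inner_diff_left)
  then show "z = y" by simp
qed (use assms in auto)

context
  fixes S :: "'a::{real_inner, complete_space} set"
  assumes S: "subspace S" "closed S"
begin

lemma orth_proj_mem: "orth_proj S x \<in> S" and orth_proj_comp: "x - orth_proj S x \<in> S\<^sup>\<bottom>"
  using orthogonal_decomposition[OF S, of x] orth_proj_eqI[OF S(1)] by metis+

lemma orth_proj_inner: "y \<in> S \<Longrightarrow> x \<bullet> y = orth_proj S x \<bullet> y"
  using orth_proj_comp[of x] by (simp add: orthogonal_comp_iff inner_diff_left)

lemma orth_proj_add: "orth_proj S (x + y) = orth_proj S x + orth_proj S y"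
proof (rule orth_proj_eqI[OF S(1)])
  have "x + y - (orth_proj S x + orth_proj S y) = (x - orth_proj S x) + (y - orth_proj S y)" by simp
  then show "x + y - (orth_proj S x + orth_proj S y) \<in> S\<^sup>\<bottom>"
    using orth_proj_comp subspace_orthogonal_comp subspace_add by metis
qed (simp add: subspace_add S orth_proj_mem)

lemma orth_proj_scaleR: "orth_proj S (c *\<^sub>R x) = c *\<^sub>R orth_proj S x"
proof (rule orth_proj_eqI[OF S(1)])
  show "c *\<^sub>R x - c *\<^sub>R orth_proj S x \<in> S\<^sup>\<bottom>"
    using orth_proj_comp subspace_orthogonal_comp subspace_scale
    by (metis scaleR_right_diff_distrib)
qed (simp add: subspace_scale S orth_proj_mem)

lemma norm_orth_proj_le: "norm (orth_proj S x) \<le> norm x"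
proof -
  have "norm (orth_proj S x) * norm (orth_proj S x) = x \<bullet> orth_proj S x"
    using orth_proj_inner[OF orth_proj_mem, of x x]
    by (simp add: power2_norm_eq_inner flip: power2_eq_square)
  also have "\<dots> \<le> norm x * norm (orth_proj S x)" by (rule norm_cauchy_schwarz)
  finally show ?thesis by (cases "orth_proj S x = 0") auto
qed

lemma orth_proj_closest: "y \<in> S \<Longrightarrow> norm (x - orth_proj S x) \<le> norm (x - y)"
proof -
  assume y: "y \<in> S"
  define p where "p = orth_proj S x"
  have "(x - p) \<bullet> (p - y) = 0"
    using orth_proj_comp[of x] orth_proj_mem[of x] y S(1)
    by (simp add: orthogonal_comp_iff subspace_diff p_def)
  then have "(norm ((x - p) + (p - y)))\<^sup>2 = (norm (x - p))\<^sup>2 + (norm (p - y))\<^sup>2"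
    using inner_commute[of "x - p" "p - y"]
    unfolding power2_norm_eq_inner inner_add_left inner_add_right by linarith
  then have "(norm (x - p))\<^sup>2 \<le> (norm (x - y))\<^sup>2" by simp
  from power2_le_imp_le[OF this] show ?thesis unfolding p_def by simp
qed

end

subsection \<open>Closed operators with closed range\<close>

lemma lin_on_subspace: "lin_on V f \<Longrightarrow> subspace V"
  and lin_on_add: "lin_on V f \<Longrightarrow> x \<in> V \<Longrightarrow> y \<in> V \<Longrightarrow> f (x + y) = f x + f y"
  and lin_on_scale: "lin_on V f \<Longrightarrow> x \<in> V \<Longrightarrow> f (c *\<^sub>R x) = c *\<^sub>R f x"
  by (auto simp: lin_on_def)

lemma lin_on_0: "lin_on V f \<Longrightarrow> f 0 = 0"
  using lin_on_scale[of V f 0 0] subspace_0[OF lin_on_subspace[of V f]] by simp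

lemma lin_on_minus: "lin_on V f \<Longrightarrow> x \<in> V \<Longrightarrow> f (- x) = - f x"
  using lin_on_scale[of V f x "-1"] by simp

lemma lin_on_diff: "lin_on V f \<Longrightarrow> x \<in> V \<Longrightarrow> y \<in> V \<Longrightarrow> f (x - y) = f x - f y"
  using lin_on_add[of V f x "- y"] lin_on_minus[of V f y] lin_on_subspace[of V f]
  by (simp add: subspace_neg)

lemma lin_on_mono: "lin_on V f \<Longrightarrow> subspace S \<Longrightarrow> S \<subseteq> V \<Longrightarrow> lin_on S f"
  unfolding lin_on_def by (meson subsetD)

lemma lin_on_subspace_image:
  assumes "lin_on V f" shows "subspace (f ` V)"
  unfolding subspace_def
proof (intro conjI ballI allI)
  show "0 \<in> f ` V" using lin_on_0[OF assms] lin_on_subspace[OF assms] subspace_0 by force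
next
  fix x y assume "x \<in> f ` V" "y \<in> f ` V"
  then obtain v w where "v \<in> V" "w \<in> V" "x = f v" "y = f w" by auto
  then show "x + y \<in> f ` V"
    using lin_on_add[OF assms, of v w] subspace_add[OF lin_on_subspace[OF assms], of v w] by force
next
  fix x c assume "x \<in> f ` V"
  then obtain v where "v \<in> V" "x = f v" by auto
  then show "c *\<^sub>R x \<in> f ` V"
    using lin_on_scale[OF assms, of v c] subspace_scale[OF lin_on_subspace[OF assms], of v c] by force
qed

lemma lin_on_subspace_ker:
  assumes "lin_on V f" shows "subspace (ker_on V f)"
  using lin_on_subspace[OF assms] lin_on_add[OF assms] lin_on_scale[OF assms] lin_on_0[OF assms]
  by (simp add: subspace_def ker_on_def)

lemma closed_op_limit:
  assumes "closed_op V f" "\<And>n. s n \<in> V" "s \<longlonglongrightarrow> v" "(\<lambda>n. f (s n)) \<longlonglongrightarrow> w"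
  shows "v \<in> V" "f v = w"
proof -
  have "closed ((\<lambda>v. (v, f v)) ` V)" using assms(1) by (simp add: closed_op_def)
  moreover have "(s n, f (s n)) \<in> (\<lambda>v. (v, f v)) ` V" for n using assms(2) by auto
  moreover have "(\<lambda>n. (s n, f (s n))) \<longlonglongrightarrow> (v, w)" using assms(3,4) by (rule tendsto_Pair)
  ultimately have "(v, w) \<in> (\<lambda>v. (v, f v)) ` V" by (rule closed_sequentially)
  then show "v \<in> V" "f v = w" by auto
qed

lemma closed_ker_on:
  assumes "closed_op V f" shows "closed (ker_on V f)"
  unfolding closed_sequential_limits
proof (intro allI impI)
  fix s l
  assume s: "(\<forall>n. s n \<in> ker_on V f) \<and> s \<longlonglongrightarrow> l"
  then have "(\<lambda>n. f (s n)) \<longlonglongrightarrow> 0" by (simp add: ker_on_def)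
  then show "l \<in> ker_on V f"
    using closed_op_limit[OF assms, of s l 0] s by (simp add: ker_on_def)
qed

lemma Cauchy_geometric:
  fixes s :: "nat \<Rightarrow> 'a::real_normed_vector"
  assumes s: "\<And>k. norm (s (Suc k) - s k) \<le> R / 2 ^ k"
  shows "Cauchy s" "norm (s k - s 0) \<le> 2 * R"
proof -
  have R: "0 \<le> R" using order_trans[OF norm_ge_zero s[of 0]] by simp
  have tele: "norm (s (m + k) - s m) \<le> 2 * R / 2 ^ m - 2 * R / 2 ^ (m + k)" for m k
  proof (induction k)
    case (Suc k)
    have "norm (s (m + Suc k) - s m)
        \<le> norm (s (Suc (m + k)) - s (m + k)) + norm (s (m + k) - s m)"
      using norm_triangle_ineq[of "s (Suc (m + k)) - s (m + k)" "s (m + k) - s m"] by simp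
    also have "\<dots> \<le> R / 2 ^ (m + k) + (2 * R / 2 ^ m - 2 * R / 2 ^ (m + k))"
      using s Suc by (intro add_mono)
    finally show ?case by (simp add: field_simps)
  qed simp
  have tail: "norm (s (m + k) - s m) \<le> 2 * R / 2 ^ m" for m k
    using tele[of m k] R by (smt (verit) divide_nonneg_pos zero_less_power)
  show "norm (s k - s 0) \<le> 2 * R" using tail[of 0 k] by simp
  show "Cauchy s"
  proof (rule metric_CauchyI)
    fix e :: real assume e: "0 < e"
    have "(\<lambda>m. 4 * R * (1 / 2) ^ m) \<longlonglongrightarrow> 4 * R * 0"
      by (intro tendsto_intros LIMSEQ_power_zero) simp
    then have "\<forall>\<^sub>F m in sequentially. 4 * R * (1 / 2) ^ m < e"
      by (rule order_tendstoD(2)) (use e in simp)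
    then obtain N where N: "4 * R * (1 / 2) ^ N < e" by (auto simp: eventually_sequentially)
    have "dist (s m) (s n) < e" if "m \<ge> N" "n \<ge> N" for m n
    proof -
      have "norm (s m - s N) \<le> 2 * R / 2 ^ N" "norm (s n - s N) \<le> 2 * R / 2 ^ N"
        using tail[of N "m - N"] tail[of N "n - N"] that by simp_all
      moreover have "dist (s m) (s n) \<le> norm (s m - s N) + norm (s n - s N)"
        using dist_triangle2[of "s m" "s n" "s N"] by (simp add: dist_norm)
      moreover have "2 * R / 2 ^ N + 2 * R / 2 ^ N < e" using N by (simp add: power_one_over)
      ultimately show ?thesis by linarith
    qed
    then show "\<exists>M. \<forall>m\<ge>M. \<forall>n\<ge>M. dist (s m) (s n) < e" by blast
  qed
qed

lemma closed_range_approx_preimage: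
  fixes f :: "'a::real_normed_vector \<Rightarrow> 'b::{real_normed_vector, complete_space}"
  assumes f: "lin_on V f" and cl: "closed (f ` V)"
  obtains M where "M > 0"
    "\<And>y e. y \<in> f ` V \<Longrightarrow> 0 < e \<Longrightarrow> \<exists>v\<in>V. norm v \<le> M * norm y \<and> norm (y - f v) < e"
proof -
  define B where "B n = f ` {v \<in> V. norm v \<le> real n}" for n
  let ?X = "top_of_set (f ` V)"
  have V: "subspace V" using f by (rule lin_on_subspace)
  have BV: "closure (B n) \<subseteq> f ` V" for n
    using cl by (intro closure_minimal) (auto simp: B_def)
  have "f ` V \<subseteq> (\<Union>n. closure (B n))"
  proof
    fix y assume "y \<in> f ` V"
    then obtain v where v: "v \<in> V" "y = f v" by auto
    obtain n where "norm v \<le> real n" using real_arch_simple by blast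
    with v have "y \<in> B n" by (auto simp: B_def)
    then show "y \<in> (\<Union>n. closure (B n))" using closure_subset by blast
  qed
  then have union: "\<Union> (range (\<lambda>n. closure (B n))) = f ` V" using BV by blast
  have "f ` V \<noteq> {}" using V subspace_0 by blast
  moreover have "?X interior_of (f ` V) = f ` V"
    by (metis interior_of_topspace topspace_euclidean_subtopology)
  ultimately have int: "?X interior_of \<Union> (range (\<lambda>n. closure (B n))) \<noteq> {}" using union by simp
  have "completely_metrizable_space ?X"
    using cl completely_metrizable_space_closedin completely_metrizable_space_euclidean
    by (metis closed_closedin)
  moreover have "closedin ?X (closure (B n))" for n
    using BV by (simp add: closed_subset)
  ultimately have "?X interior_of \<Union> (range (\<lambda>n. closure (B n))) = {}"
    if "\<And>n. ?X interior_of (closure (B n)) = {}"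
    using that by (intro Baire_category_alt) auto
  with int obtain n where n: "?X interior_of (closure (B n)) \<noteq> {}" by metis
  then obtain T y0 where T: "openin ?X T" "T \<subseteq> closure (B n)" "y0 \<in> T"
    by (auto simp: interior_of_def)
  then obtain r where r: "r > 0" "ball y0 r \<inter> f ` V \<subseteq> closure (B n)" and y0: "y0 \<in> f ` V"
    unfolding openin_contains_ball by blast
  have small: "\<exists>v\<in>V. norm v \<le> 2 * real n \<and> norm (y - f v) < e"
    if y: "y \<in> f ` V" "norm y < r" and e: "0 < e" for y e
  proof -
    have "y0 + y \<in> f ` V" using y0 y lin_on_subspace_image[OF f] subspace_add by blast
    moreover have "y0 + y \<in> ball y0 r" using y by (simp add: dist_norm)
    ultimately have "y0 + y \<in> closure (B n)" using r by blast
    then obtain b where b: "b \<in> B n" "dist b (y0 + y) < e / 2"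
      using e by (metis closure_approachable half_gt_zero)
    have "y0 \<in> closure (B n)" using r y0 by auto
    then obtain b' where b': "b' \<in> B n" "dist b' y0 < e / 2"
      using e by (metis closure_approachable half_gt_zero)
    obtain v v' where v: "v \<in> V" "norm v \<le> n" "b = f v" "v' \<in> V" "norm v' \<le> n" "b' = f v'"
      using b b' by (auto simp: B_def)
    have "norm (y - f (v - v')) \<le> dist b (y0 + y) + dist b' y0"
      using norm_triangle_ineq4[of "b' - y0" "b - (y0 + y)"] v
      by (simp add: lin_on_diff[OF f] dist_norm algebra_simps)
    also have "\<dots> < e" using b b' by simp
    finally have "norm (y - f (v - v')) < e" .
    moreover have "norm (v - v') \<le> 2 * real n" using norm_triangle_ineq4[of v v'] v by linarith
    moreover have "v - v' \<in> V" using v V subspace_diff by blast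
    ultimately show ?thesis by blast
  qed
  show thesis
  proof
    show "4 * (real n + 1) / r > 0" using r by simp
    fix y e assume y: "y \<in> f ` V" and e: "0 < (e::real)"
    show "\<exists>v\<in>V. norm v \<le> 4 * (real n + 1) / r * norm y \<and> norm (y - f v) < e"
    proof (cases "y = 0")
      case True
      then show ?thesis using V e by (intro bexI[of _ 0]) (auto simp: lin_on_0[OF f] subspace_0)
    next
      case False
      define t where "t = r / (2 * norm y)"
      have t: "t > 0" using False r by (simp add: t_def)
      have "t *\<^sub>R y \<in> f ` V" using y lin_on_subspace_image[OF f] subspace_scale by blast
      moreover have "norm (t *\<^sub>R y) < r" using False r by (simp add: t_def)
      ultimately obtain v where v: "v \<in> V" "norm v \<le> 2 * real n" "norm (t *\<^sub>R y - f v) < t * e"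
        using small t e by (meson mult_pos_pos)
      let ?v = "(1 / t) *\<^sub>R v"
      have "y - f ?v = (1 / t) *\<^sub>R (t *\<^sub>R y - f v)"
        using t v by (simp add: lin_on_scale[OF f] scaleR_right_diff_distrib)
      then have "norm (y - f ?v) = norm (t *\<^sub>R y - f v) / t" using t by simp
      then have 1: "norm (y - f ?v) < e" using v(3) t by (simp add: divide_less_eq mult.commute)
      have "norm ?v = norm v / t" using t by simp
      also have "\<dots> \<le> 2 * (real n + 1) / t" using v(2) t by (intro divide_right_mono) auto
      also have "\<dots> = 4 * (real n + 1) / r * norm y"
        using False r by (simp add: t_def)
      finally have 2: "norm ?v \<le> 4 * (real n + 1) / r * norm y" .
      have "?v \<in> V" using v V subspace_scale by blast
      then show ?thesis using 1 2 by blast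
    qed
  qed
qed

lemma closed_range_bounded_preimage:
  fixes f :: "'a::{real_normed_vector, complete_space} \<Rightarrow> 'b::{real_normed_vector, complete_space}"
  assumes f: "closed_op V f" and cl: "closed (f ` V)"
  obtains M where "M > 0" "\<And>y. y \<in> f ` V \<Longrightarrow> \<exists>v\<in>V. f v = y \<and> norm v \<le> M * norm y"
proof -
  have lin: "lin_on V f" using f by (simp add: closed_op_def)
  have V: "subspace V" using lin by (rule lin_on_subspace)
  obtain M where M: "M > 0"
    and ap: "\<And>y e. y \<in> f ` V \<Longrightarrow> 0 < e \<Longrightarrow> \<exists>v\<in>V. norm v \<le> M * norm y \<and> norm (y - f v) < e"
    using closed_range_approx_preimage[OF lin cl] by metis
  show thesis
  proof
    show "2 * M > 0" using M by simp
    fix y assume y: "y \<in> f ` V"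
    show "\<exists>v\<in>V. f v = y \<and> norm v \<le> 2 * M * norm y"
    proof (cases "y = 0")
      case True
      then show ?thesis using V by (intro bexI[of _ 0]) (auto simp: lin_on_0[OF lin] subspace_0)
    next
      case False
      have "\<exists>s. \<forall>k. (s k \<in> V \<and> norm (y - f (s k)) \<le> norm y / 2 ^ k \<and> (k = 0 \<longrightarrow> s k = 0))
                \<and> norm (s (Suc k) - s k) \<le> M * norm y / 2 ^ k"
      proof (rule dependent_nat_choice)
        show "\<exists>x. x \<in> V \<and> norm (y - f x) \<le> norm y / 2 ^ 0 \<and> ((0::nat) = 0 \<longrightarrow> x = 0)"
          using V by (intro exI[of _ 0]) (auto simp: lin_on_0[OF lin] subspace_0)
      next
        fix x and k :: nat
        assume x: "x \<in> V \<and> norm (y - f x) \<le> norm y / 2 ^ k \<and> (k = 0 \<longrightarrow> x = 0)"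
        then have "y - f x \<in> f ` V"
          using y subspace_diff[OF lin_on_subspace_image[OF lin]] by blast
        moreover have "0 < norm y / 2 ^ Suc k" using False by simp
        ultimately obtain v where v: "v \<in> V" "norm v \<le> M * norm (y - f x)"
          "norm (y - f x - f v) < norm y / 2 ^ Suc k" using ap by blast
        have "M * norm (y - f x) \<le> M * (norm y / 2 ^ k)" using x M by (intro mult_left_mono) auto
        then have "norm (x + v - x) \<le> M * norm y / 2 ^ k" using v(2) by simp
        moreover have "x + v \<in> V" using x v V subspace_add by blast
        moreover have "norm (y - f (x + v)) \<le> norm y / 2 ^ Suc k"
          using v x lin_on_add[OF lin, of x v] by (simp add: diff_diff_eq less_imp_le)
        ultimately show "\<exists>z. (z \<in> V \<and> norm (y - f z) \<le> norm y / 2 ^ Suc k \<and> (Suc k = 0 \<longrightarrow> z = 0))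
              \<and> norm (z - x) \<le> M * norm y / 2 ^ k" by blast
      qed
      then obtain s where s: "\<And>k. s k \<in> V" "\<And>k. norm (y - f (s k)) \<le> norm y / 2 ^ k"
        "s 0 = 0" and step: "\<And>k. norm (s (Suc k) - s k) \<le> M * norm y / 2 ^ k" by metis
      obtain v where v: "s \<longlonglongrightarrow> v"
        using Cauchy_geometric(1)[OF step] Cauchy_convergent convergent_def by blast
      have "norm (s k) \<le> 2 * (M * norm y)" for k
        using Cauchy_geometric(2)[OF step, of k] s(3) by simp
      then have bd: "norm v \<le> 2 * (M * norm y)"
        by (intro LIMSEQ_le_const2[OF tendsto_norm[OF v]]) auto
      have "(\<lambda>k. norm y * (1 / 2) ^ k) \<longlonglongrightarrow> norm y * 0"
        by (intro tendsto_mult tendsto_const LIMSEQ_power_zero) simp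
      then have "(\<lambda>k. norm y * (1 / 2) ^ k) \<longlonglongrightarrow> 0" by simp
      then have "(\<lambda>k. y - f (s k)) \<longlonglongrightarrow> 0"
        by (rule Lim_null_comparison[rotated]) (use s(2) in \<open>simp add: power_one_over\<close>)
      from tendsto_diff[OF tendsto_const this, of y] have "(\<lambda>k. f (s k)) \<longlonglongrightarrow> y" by simp
      from closed_op_limit[OF f s(1) v this] bd show ?thesis by (auto simp: mult.assoc)
    qed
  qed
qed

subsection \<open>Graph norm and best approximation\<close>

lemma graph_norm_eq_norm_Pair: "graph_norm d v = norm (v, d v)"
  by (simp add: graph_norm_def graph_inner_def norm_Pair power2_norm_eq_inner)

lemma graph_norm_nonneg [simp]: "0 \<le> graph_norm d v"
  by (simp add: graph_norm_eq_norm_Pair)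

lemma norm_le_graph_norm: "norm v \<le> graph_norm d v"
  and norm_image_le_graph_norm: "norm (d v) \<le> graph_norm d v"
  using norm_fst_le[of v "d v"] norm_snd_le[of "d v" v]
  by (simp_all add: graph_norm_eq_norm_Pair)

lemma graph_norm_le: "graph_norm d v \<le> norm v + norm (d v)"
  unfolding graph_norm_eq_norm_Pair by (rule norm_Pair_le)

lemma graph_norm_ker: "d v = 0 \<Longrightarrow> graph_norm d v = norm v"
  by (simp add: graph_norm_eq_norm_Pair norm_Pair)

lemma graph_norm_triangle_diff:
  assumes "lin_on V d" "x \<in> V" "y \<in> V"
  shows "graph_norm d (x - y) \<le> graph_norm d x + graph_norm d y"
  using norm_triangle_ineq4[of "(x, d x)" "(y, d y)"]
  by (simp add: graph_norm_eq_norm_Pair lin_on_diff[OF assms])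

lemma projection_quasi_optimal:
  assumes d: "lin_on V d" and p: "projection_onto V S p" and S: "subspace S" "S \<subseteq> V"
    and K: "0 \<le> K" "\<And>v. v \<in> V \<Longrightarrow> graph_norm d (p v) \<le> K * graph_norm d v" and x: "x \<in> V"
  shows "graph_norm d (x - p x) \<le> (1 + K) * best_error d S x"
proof -
  have lp: "lin_on V p" using p by (simp add: projection_onto_def)
  have V: "subspace V" using d by (rule lin_on_subspace)
  have ne: "S \<noteq> {}" using S subspace_0 by blast
  have "graph_norm d (x - p x) / (1 + K) \<le> graph_norm d (x - y)" if y: "y \<in> S" for y
  proof -
    have yV: "y \<in> V" using y S by blast
    have pV: "p v \<in> V" if "v \<in> V" for v using that p S by (auto simp: projection_onto_def)
    have "p y = y" using p y by (auto simp: projection_onto_def)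
    then have eq: "x - p x = (x - y) - p (x - y)" using lin_on_diff[OF lp x yV] by simp
    have xy: "x - y \<in> V" using V x yV subspace_diff by blast
    have "graph_norm d (x - p x) \<le> graph_norm d (x - y) + graph_norm d (p (x - y))"
      unfolding eq by (rule graph_norm_triangle_diff[OF d xy pV[OF xy]])
    also have "\<dots> \<le> (1 + K) * graph_norm d (x - y)"
      using K(2)[OF xy] by (simp add: distrib_right)
    finally show ?thesis using K(1) by (simp add: divide_le_eq mult.commute)
  qed
  then have "graph_norm d (x - p x) / (1 + K) \<le> best_error d S x"
    unfolding best_error_def using ne by (intro cINF_greatest)
  then show ?thesis using K(1) by (simp add: divide_le_eq mult.commute)
qed

subsection \<open>Stability of the mixed problem\<close>

locale hilbert_complex =
  fixes S :: "'w::{real_inner, complete_space} set" and d :: "'w \<Rightarrow> 'w"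
  assumes lin: "lin_on S d"
    and range_ker: "d ` S \<subseteq> ker_on S d"
    and closed_ker: "closed (ker_on S d)"
    and closed_range: "closed (d ` S)"
begin

lemma sub: "subspace S"
  using lin by (rule lin_on_subspace)

lemma sub_ker: "subspace (ker_on S d)"
  using lin by (rule lin_on_subspace_ker)

lemma sub_range: "subspace (d ` S)"
  using lin by (rule lin_on_subspace_image)

lemma kerD: "x \<in> ker_on S d \<Longrightarrow> x \<in> S" "x \<in> ker_on S d \<Longrightarrow> d x = 0"
  by (auto simp: ker_on_def)

lemma range_in: "x \<in> S \<Longrightarrow> d x \<in> ker_on S d"
  using range_ker by blast

lemma harmonicD:
  assumes "x \<in> harmonic S d"
  shows "x \<in> ker_on S d" "y \<in> S \<Longrightarrow> x \<bullet> d y = 0"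
  using assms by (auto simp: harmonic_def orthogonal_comp_iff)

lemma sub_harmonic: "subspace (harmonic S d)"
  unfolding harmonic_def using sub_ker subspace_orthogonal_comp by (rule subspace_inter)

lemma closed_harmonic: "closed (harmonic S d)"
  unfolding harmonic_def using closed_ker closed_orthogonal_comp by (rule closed_Int)

lemma ker_decomposition:
  assumes "z \<in> ker_on S d"
  obtains b where "b \<in> d ` S" "z - b \<in> harmonic S d"
proof -
  obtain b where b: "b \<in> d ` S" "z - b \<in> (d ` S)\<^sup>\<bottom>"
    using orthogonal_decomposition[OF sub_range closed_range] by blast
  then have "z - b \<in> ker_on S d" using assms range_ker sub_ker subspace_diff by blast
  with b that show thesis by (simp add: harmonic_def)
qed

lemma hodge_decomposition:
  assumes "w \<in> S"
  obtains b q z where "b \<in> d ` S" "q \<in> harmonic S d" "z \<in> S" "z \<in> (ker_on S d)\<^sup>\<bottom>" "w = b + q + z"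
proof -
  obtain k where k: "k \<in> ker_on S d" "w - k \<in> (ker_on S d)\<^sup>\<bottom>"
    using orthogonal_decomposition[OF sub_ker closed_ker] by blast
  obtain b where b: "b \<in> d ` S" "k - b \<in> harmonic S d"
    using ker_decomposition[OF k(1)] by blast
  have "w - k \<in> S" using assms kerD(1)[OF k(1)] sub subspace_diff by blast
  moreover have "w = b + (k - b) + (w - k)" by simp
  ultimately show thesis using that b k by blast
qed

lemma orth_proj_harmonic:
  assumes "z \<in> ker_on S d"
  shows "z - orth_proj (harmonic S d) z \<in> d ` S"
proof -
  obtain b where b: "b \<in> d ` S" "z - b \<in> harmonic S d"
    using ker_decomposition[OF assms] by blast
  then have "orth_proj (harmonic S d) z = z - b"
    by (intro orth_proj_eqI[OF sub_harmonic])
      (auto simp: orthogonal_comp_iff inner_commute dest: harmonicD(2))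
  with b show ?thesis by simp
qed

lemma range_orthogonal_preimage:
  assumes "b \<in> d ` S"
  obtains \<rho> where "\<rho> \<in> S" "\<rho> \<in> (ker_on S d)\<^sup>\<bottom>" "d \<rho> = b"
proof -
  obtain x where x: "x \<in> S" "b = d x" using assms by blast
  obtain k where k: "k \<in> ker_on S d" "x - k \<in> (ker_on S d)\<^sup>\<bottom>"
    using orthogonal_decomposition[OF sub_ker closed_ker] by blast
  have "x - k \<in> S" using x kerD(1)[OF k(1)] sub subspace_diff by blast
  moreover have "d (x - k) = b" using x k lin_on_diff[OF lin] kerD[OF k(1)] by simp
  ultimately show thesis using that k by blast
qed

text \<open>The components are bounded one after the other, by testing with \<open>v = r + d s\<close>, with the part
  \<open>v = z\<close> of \<open>w\<close> orthogonal to the kernel, with the harmonic part \<open>q\<close> of \<open>w\<close>, with \<open>t = - \<rho>\<close> where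
  \<open>d \<rho> = b\<close> is the part of \<open>w\<close> in the range, and finally with \<open>t = s\<close>.\<close>

lemma mixed_stability:
  assumes c: "0 \<le> c" "\<And>z. z \<in> S \<Longrightarrow> z \<in> (ker_on S d)\<^sup>\<bottom> \<Longrightarrow> norm z \<le> c * norm (d z)"
    and mem: "s \<in> S" "w \<in> S" "r \<in> harmonic S d" and e: "0 \<le> e"
    and e1: "\<And>t. t \<in> S \<Longrightarrow> s \<bullet> t - w \<bullet> d t \<le> e * graph_norm d t"
    and e2: "\<And>v. v \<in> S \<Longrightarrow> d s \<bullet> v + d w \<bullet> d v + r \<bullet> v \<le> e * graph_norm d v"
    and e3: "\<And>q. q \<in> harmonic S d \<Longrightarrow> w \<bullet> q \<le> e * norm q"
  shows "graph_norm d s + graph_norm d w + norm r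
    \<le> ((1 + c) * (c\<^sup>2 + 3 * c + 4) + (1 + c)\<^sup>2 + c + 4) * e"
proof -
  have rk: "r \<in> ker_on S d" and dsk: "d s \<in> ker_on S d"
    using harmonicD(1)[OF mem(3)] range_in[OF mem(1)] by auto
  have rds: "r \<bullet> d s = 0" using harmonicD(2)[OF mem(3) mem(1)] .
  have zk: "z \<bullet> k = 0" if "z \<in> (ker_on S d)\<^sup>\<bottom>" "k \<in> ker_on S d" for z k
    using that by (simp add: orthogonal_comp_iff)
  have cancel: "a \<le> b" if "a * a \<le> b * a" "0 \<le> a" "0 \<le> b" for a b :: real
    using that by (cases "a = 0") auto

  have "r + d s \<in> ker_on S d" using rk dsk sub_ker subspace_add by blast
  note rs = kerD[OF this]
  have sq: "(norm (r + d s))\<^sup>2 = (norm r)\<^sup>2 + (norm (d s))\<^sup>2"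
    using rds by (simp add: power2_norm_eq_inner inner_add_left inner_add_right inner_commute)
  have "norm (r + d s) * norm (r + d s) = d s \<bullet> (r + d s) + d w \<bullet> d (r + d s) + r \<bullet> (r + d s)"
    using rs(2)
    by (simp add: power2_norm_eq_inner inner_add_left inner_add_right flip: power2_eq_square)
  also have "\<dots> \<le> e * norm (r + d s)" using e2[OF rs(1)] rs(2) by (simp add: graph_norm_ker)
  finally have rse: "norm (r + d s) \<le> e" by (rule cancel) (use e in simp_all)
  have r: "norm r \<le> e" and ds: "norm (d s) \<le> e"
    using sq rse power2_le_imp_le[of "norm r" "norm (r + d s)"]
      power2_le_imp_le[of "norm (d s)" "norm (r + d s)"] by auto

  obtain b q z where w: "b \<in> d ` S" "q \<in> harmonic S d" "z \<in> S" "z \<in> (ker_on S d)\<^sup>\<bottom>" "w = b + q + z"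
    using hodge_decomposition[OF mem(2)] by blast
  have bk: "b \<in> ker_on S d" and qk: "q \<in> ker_on S d"
    using w range_ker harmonicD(1) by auto
  have bqS: "b \<in> S" "q \<in> S" "b + q \<in> S" using kerD(1) bk qk sub subspace_add by blast+
  have qb: "q \<bullet> b = 0" using w harmonicD(2) by auto
  have zb: "z \<bullet> b = 0" and zq: "z \<bullet> q = 0" using zk w bk qk by auto

  have dw: "d w = d z"
    using w lin_on_add[OF lin bqS(3) w(3)] lin_on_add[OF lin bqS(1,2)] kerD(2)[OF bk] kerD(2)[OF qk]
    by simp
  have gz: "graph_norm d z \<le> (1 + c) * norm (d z)"
    using graph_norm_le[of d z] c(2)[OF w(3,4)] by (simp add: distrib_right)
  have "norm (d z) * norm (d z) = d s \<bullet> z + d w \<bullet> d z + r \<bullet> z"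
    using zk[OF w(4) dsk] zk[OF w(4) rk] dw
    by (simp add: inner_commute power2_norm_eq_inner flip: power2_eq_square)
  also have "\<dots> \<le> e * ((1 + c) * norm (d z))"
    using e2[OF w(3)] mult_left_mono[OF gz e] by linarith
  finally have "norm (d z) * norm (d z) \<le> ((1 + c) * e) * norm (d z)"
    by (simp add: algebra_simps)
  then have dz: "norm (d z) \<le> (1 + c) * e" by (rule cancel) (use c(1) e in simp_all)
  have nz: "norm z \<le> c * (1 + c) * e"
    using c(2)[OF w(3,4)] mult_left_mono[OF dz c(1)] by (simp add: mult.assoc)

  have "norm q * norm q = w \<bullet> q"
    using w(5) qb zq
    by (simp add: inner_add_left inner_add_right inner_commute power2_norm_eq_inner
        flip: power2_eq_square)
  also have "\<dots> \<le> e * norm q" using e3 w by blast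
  finally have nq: "norm q \<le> e" by (rule cancel) (use e in simp_all)

  obtain \<rho> where \<rho>: "\<rho> \<in> S" "\<rho> \<in> (ker_on S d)\<^sup>\<bottom>" "d \<rho> = b"
    using range_orthogonal_preimage[OF w(1)] by blast
  have n\<rho>: "norm \<rho> \<le> c * norm b" using c(2)[OF \<rho>(1,2)] \<rho>(3) by simp
  have g\<rho>: "graph_norm d (- \<rho>) \<le> (1 + c) * norm b"
    using graph_norm_le[of d "- \<rho>"] n\<rho> \<rho>(3) lin_on_minus[OF lin \<rho>(1)] by (simp add: distrib_right)
  have "norm b * norm b = w \<bullet> b"
    using w(5) qb zb
    by (simp add: inner_add_left inner_add_right inner_commute power2_norm_eq_inner
        flip: power2_eq_square)
  also have "\<dots> = s \<bullet> \<rho> + (s \<bullet> (- \<rho>) - w \<bullet> d (- \<rho>))"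
    using lin_on_minus[OF lin \<rho>(1)] \<rho>(3) by simp
  also have "\<dots> \<le> norm s * (c * norm b) + e * ((1 + c) * norm b)"
  proof (rule add_mono)
    show "s \<bullet> \<rho> \<le> norm s * (c * norm b)"
      using norm_cauchy_schwarz[of s \<rho>] mult_left_mono[OF n\<rho> norm_ge_zero[of s]] by linarith
    have "- \<rho> \<in> S" using \<rho>(1) sub subspace_neg by blast
    then show "s \<bullet> (- \<rho>) - w \<bullet> d (- \<rho>) \<le> e * ((1 + c) * norm b)"
      using e1[of "- \<rho>"] mult_left_mono[OF g\<rho> e] by linarith
  qed
  finally have "norm b * norm b \<le> (c * norm s + (1 + c) * e) * norm b"
    by (simp add: algebra_simps)
  then have nb: "norm b \<le> c * norm s + (1 + c) * e"
    by (rule cancel) (use c(1) e in simp_all)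

  have nw: "norm w \<le> c * norm s + ((1 + c)\<^sup>2 + 1) * e"
    using norm_triangle_ineq[of "b + q" z] norm_triangle_ineq[of b q] nb nq nz w(5)
    by (simp add: power2_eq_square algebra_simps)
  have ns: "norm s \<le> (c\<^sup>2 + 3 * c + 4) * e"
  proof (rule ccontr)
    assume "\<not> norm s \<le> (c\<^sup>2 + 3 * c + 4) * e"
    then have big: "(c\<^sup>2 + 3 * c + 4) * e < norm s" by simp
    have "1 * e \<le> (c\<^sup>2 + 3 * c + 4) * e" using c(1) e by (intro mult_right_mono) auto
    then have es: "e < norm s" using big by simp
    have "norm s * norm s = (s \<bullet> s - w \<bullet> d s) + w \<bullet> d s"
      by (simp add: power2_norm_eq_inner flip: power2_eq_square)
    also have "\<dots> \<le> e * (norm s + e) + (c * norm s + ((1 + c)\<^sup>2 + 1) * e) * e"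
    proof (rule add_mono)
      show "s \<bullet> s - w \<bullet> d s \<le> e * (norm s + e)"
        using e1[OF mem(1)] graph_norm_le[of d s] ds
          mult_left_mono[OF order_trans[OF graph_norm_le[of d s] add_left_mono[OF ds]] e]
        by linarith
      have "w \<bullet> d s \<le> norm w * norm (d s)" by (rule norm_cauchy_schwarz)
      also have "\<dots> \<le> (c * norm s + ((1 + c)\<^sup>2 + 1) * e) * e"
        using nw ds order_trans[OF norm_ge_zero nw] by (intro mult_mono) auto
      finally show "w \<bullet> d s \<le> (c * norm s + ((1 + c)\<^sup>2 + 1) * e) * e" .
    qed
    also have "\<dots> = (c + 1) * e * norm s + (c\<^sup>2 + 2 * c + 3) * e * e"
      by (simp add: power2_eq_square algebra_simps)
    also have "\<dots> \<le> (c + 1) * e * norm s + (c\<^sup>2 + 2 * c + 3) * e * norm s"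
      using c(1) e es by (intro add_left_mono mult_left_mono) auto
    also have "\<dots> = (c\<^sup>2 + 3 * c + 4) * e * norm s" by (simp add: algebra_simps)
    also have "\<dots> < norm s * norm s" using big e es by (intro mult_strict_right_mono) auto
    finally show False by simp
  qed
  have "graph_norm d s + graph_norm d w + norm r
      \<le> (norm s + e) + (norm w + (1 + c) * e) + e"
    using graph_norm_le[of d s] graph_norm_le[of d w] ds dz dw r by simp
  also have "\<dots> \<le> (1 + c) * norm s + ((1 + c)\<^sup>2 + c + 4) * e"
    using nw by (simp add: algebra_simps)
  also have "\<dots> \<le> (1 + c) * ((c\<^sup>2 + 3 * c + 4) * e) + ((1 + c)\<^sup>2 + c + 4) * e"
    using ns c(1) by (intro add_right_mono mult_left_mono) auto
  finally show ?thesis by (simp add: algebra_simps)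
qed

end

subsection \<open>Subcomplexes with bounded commuting projections\<close>

locale hilbert_subcomplex = full: hilbert_complex V d
  for V :: "'w::{real_inner, complete_space} set" and d :: "'w \<Rightarrow> 'w" +
  fixes S :: "'w set" and p :: "'w \<Rightarrow> 'w" and K :: real
  assumes graph_closed: "graph_closed_subspace V d S"
    and invariant: "d ` S \<subseteq> S"
    and proj: "projection_onto V S p"
    and K_nonneg: "0 \<le> K"
    and K_bound: "\<And>v. v \<in> V \<Longrightarrow> graph_norm d (p v) \<le> K * graph_norm d v"
    and commute: "\<And>v. v \<in> V \<Longrightarrow> p (d v) = d (p v)"
begin

lemma S_sub: "subspace S" and S_V: "x \<in> S \<Longrightarrow> x \<in> V" and S_le: "S \<subseteq> V"
  using graph_closed by (auto simp: graph_closed_subspace_def)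

lemma p_lin: "lin_on V p" and p_in: "x \<in> V \<Longrightarrow> p x \<in> S" and p_id: "x \<in> S \<Longrightarrow> p x = x"
  using proj by (auto simp: projection_onto_def)

lemma p_range: "b \<in> d ` V \<Longrightarrow> p b \<in> d ` S"
  using commute p_in by auto

lemma p_ker: "k \<in> ker_on V d \<Longrightarrow> p k \<in> ker_on S d"
  using commute[of k] p_in[of k] lin_on_0[OF p_lin] by (simp add: ker_on_def)

lemma ker_on_subspace_eq: "ker_on S d = ker_on V d \<inter> S"
  using S_V by (auto simp: ker_on_def)

lemma range_subspace_eq: "d ` S = d ` V \<inter> S"
proof
  show "d ` V \<inter> S \<subseteq> d ` S"
  proof
    fix x assume "x \<in> d ` V \<inter> S"
    then show "x \<in> d ` S" using p_range[of x] p_id[of x] by simp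
  qed
qed (use invariant S_V in auto)

lemma closed_ker_S: "closed (ker_on S d)"
  unfolding closed_sequential_limits
proof (intro allI impI)
  fix s l
  assume s: "(\<forall>n. s n \<in> ker_on S d) \<and> s \<longlonglongrightarrow> l"
  then have sk: "s n \<in> ker_on V d" and sS: "s n \<in> S" for n by (auto simp: ker_on_subspace_eq)
  have l: "l \<in> ker_on V d"
    using closed_sequentially[OF full.closed_ker] sk s by metis
  have "d (s n - l) = 0" for n
    using subspace_diff[OF full.sub_ker sk l] full.kerD(2) by blast
  then have "graph_norm d (s n - l) = norm (s n - l)" for n by (rule graph_norm_ker)
  moreover have "(\<lambda>n. norm (s n - l)) \<longlonglongrightarrow> 0"
    using s by (simp add: LIM_zero tendsto_norm_zero)
  ultimately have "(\<lambda>n. graph_norm d (s n - l)) \<longlonglongrightarrow> 0" by simp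
  then have "l \<in> S"
    using graph_closed sS full.kerD(1)[OF l] unfolding graph_closed_subspace_def by blast
  with l show "l \<in> ker_on S d" by (simp add: ker_on_subspace_eq)
qed

sublocale sub: hilbert_complex S d
proof
  show "lin_on S d" using lin_on_mono[OF full.lin S_sub S_le] .
  show "d ` S \<subseteq> ker_on S d"
    using invariant full.range_ker S_V by (auto simp: ker_on_subspace_eq)
  show "closed (ker_on S d)" by (rule closed_ker_S)
  have "d ` S = d ` V \<inter> ker_on S d"
    using full.range_ker by (auto simp: range_subspace_eq ker_on_subspace_eq)
  then show "closed (d ` S)" using full.closed_range closed_ker_S by (simp add: closed_Int)
qed

lemma discrete_poincare:
  assumes M: "\<And>y. y \<in> d ` V \<Longrightarrow> \<exists>v\<in>V. d v = y \<and> norm v \<le> M * norm y"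
    and z: "z \<in> S" "z \<in> (ker_on S d)\<^sup>\<bottom>"
  shows "norm z \<le> K * (M + 1) * norm (d z)"
proof -
  obtain v where v: "v \<in> V" "d v = d z" "norm v \<le> M * norm (d z)"
    using M[of "d z"] S_V[OF z(1)] by blast
  have "d (p v) = p (d z)" using commute[OF v(1)] v(2) by simp
  also have "\<dots> = d z" using p_id invariant z(1) by blast
  finally have "d (z - p v) = 0" using lin_on_diff[OF sub.lin z(1) p_in[OF v(1)]] by simp
  moreover have "z - p v \<in> S" using z(1) p_in[OF v(1)] S_sub subspace_diff by blast
  ultimately have "z \<bullet> (z - p v) = 0" using z(2) by (simp add: orthogonal_comp_iff ker_on_def)
  then have "norm z * norm z = z \<bullet> p v"
    by (simp add: inner_diff_right power2_norm_eq_inner flip: power2_eq_square)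
  also have "\<dots> \<le> norm z * norm (p v)" by (rule norm_cauchy_schwarz)
  finally have "norm z \<le> norm (p v)" by (cases "z = 0") auto
  also have "\<dots> \<le> graph_norm d (p v)" by (rule norm_le_graph_norm)
  also have "\<dots> \<le> K * graph_norm d v" by (rule K_bound[OF v(1)])
  also have "\<dots> \<le> K * ((M + 1) * norm (d z))"
    using graph_norm_le[of d v] v K_nonneg by (intro mult_left_mono) (auto simp: distrib_right)
  finally show ?thesis by (simp add: mult.assoc)
qed

lemma quasi_optimal:
  "x \<in> V \<Longrightarrow> graph_norm d (x - p x) \<le> (1 + K) * best_error d S x"
  by (rule projection_quasi_optimal[OF full.lin proj S_sub S_le K_nonneg K_bound])

abbreviation "hproj \<equiv> orth_proj (harmonic V d)"

lemma harm_in: "hproj x \<in> harmonic V d"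
  by (rule orth_proj_mem[OF full.sub_harmonic full.closed_harmonic])

lemma harmonic_defect_bounded_linear: "bounded_linear (\<lambda>w. hproj w - p (hproj w))"
proof (rule bounded_linear_intro[where K = "1 + K"])
  have V: "hproj x \<in> V" and dh: "d (hproj x) = 0" for x
    using full.kerD[OF full.harmonicD(1)[OF harm_in]] by blast+
  note P = full.sub_harmonic full.closed_harmonic
  fix x y :: 'w and r :: real
  show "hproj (x + y) - p (hproj (x + y)) = hproj x - p (hproj x) + (hproj y - p (hproj y))"
    by (simp add: orth_proj_add[OF P] lin_on_add[OF p_lin V V])
  show "hproj (r *\<^sub>R x) - p (hproj (r *\<^sub>R x)) = r *\<^sub>R (hproj x - p (hproj x))"
    by (simp add: orth_proj_scaleR[OF P] lin_on_scale[OF p_lin V] scaleR_right_diff_distrib)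
  have "norm (hproj x - p (hproj x)) \<le> norm (hproj x) + norm (p (hproj x))" by (rule norm_triangle_ineq4)
  also have "\<dots> \<le> norm (hproj x) + K * norm (hproj x)"
    using norm_le_graph_norm[of "p (hproj x)" d] K_bound[OF V[of x]] graph_norm_ker[of d "hproj x", OF dh]
    by simp
  also have "\<dots> = (1 + K) * norm (hproj x)" by (simp add: distrib_right)
  also have "\<dots> \<le> (1 + K) * norm x"
    using norm_orth_proj_le[OF P, of x] K_nonneg by (intro mult_left_mono) auto
  finally show "norm (hproj x - p (hproj x)) \<le> norm x * (1 + K)" by (simp add: mult.commute)
qed

lemma discrete_harmonic_range_part:
  assumes q: "q \<in> harmonic S d"
  shows "norm (q - hproj q) \<le> norm (hproj q - p (hproj q))"
proof -
  have qS: "q \<in> ker_on S d" by (rule sub.harmonicD(1)[OF q])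
  then have qV: "q \<in> ker_on V d" and qS': "q \<in> S" by (auto simp: ker_on_subspace_eq)
  have hV: "hproj q \<in> V" using full.kerD(1)[OF full.harmonicD(1)[OF harm_in]] .
  have r: "q - hproj q \<in> d ` V" by (rule full.orth_proj_harmonic[OF qV])
  have eq: "p (q - hproj q) = q - p (hproj q)"
    using lin_on_diff[OF p_lin full.kerD(1)[OF qV] hV] p_id[OF qS'] by simp
  then have b: "q - p (hproj q) \<in> d ` S" using p_range[OF r] by simp
  then have bV: "q - p (hproj q) \<in> d ` V" by (simp add: range_subspace_eq)
  have "q \<bullet> (q - p (hproj q)) = 0" using b sub.harmonicD(2)[OF q] by auto
  moreover have "hproj q \<bullet> (q - p (hproj q)) = 0" using bV full.harmonicD(2)[OF harm_in] by auto
  ultimately have "(q - hproj q) \<bullet> (q - p (hproj q)) = 0" by (simp add: inner_diff_left)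
  moreover have "(q - hproj q) \<bullet> (q - hproj q)
      = (q - hproj q) \<bullet> (q - p (hproj q)) + (q - hproj q) \<bullet> - (hproj q - p (hproj q))"
    by (simp add: inner_diff_right)
  ultimately have "norm (q - hproj q) * norm (q - hproj q) = (q - hproj q) \<bullet> - (hproj q - p (hproj q))"
    by (simp add: power2_norm_eq_inner flip: power2_eq_square)
  also have "\<dots> \<le> norm (q - hproj q) * norm (- (hproj q - p (hproj q)))" by (rule norm_cauchy_schwarz)
  finally show ?thesis by (cases "q - hproj q = 0") (auto simp: norm_minus_commute)
qed

lemma harmonic_consistency:
  assumes u: "u \<in> V" "\<And>h. h \<in> harmonic V d \<Longrightarrow> u \<bullet> h = 0" and q: "q \<in> harmonic S d"
  defines "uB \<equiv> orth_proj (d ` V) u"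
  shows "\<bar>u \<bullet> q\<bar> \<le> norm (uB - p uB) * (onorm (\<lambda>w. hproj w - p (hproj w)) * norm q)"
proof -
  note P = full.sub_range full.closed_range
  have qV: "q \<in> ker_on V d" using sub.harmonicD(1)[OF q] by (simp add: ker_on_subspace_eq)
  have r: "q - hproj q \<in> d ` V" by (rule full.orth_proj_harmonic[OF qV])
  have uB: "uB \<in> d ` V" unfolding uB_def by (rule orth_proj_mem[OF P])
  have pS: "p uB \<in> d ` S" by (rule p_range[OF uB])
  then have pV: "p uB \<in> d ` V" by (simp add: range_subspace_eq)
  have "u \<bullet> q = u \<bullet> (q - hproj q)" using u(2)[OF harm_in[of q]] by (simp add: inner_diff_right)
  also have "\<dots> = uB \<bullet> (q - hproj q)" unfolding uB_def by (rule orth_proj_inner[OF P r])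
  also have "\<dots> = (uB - p uB) \<bullet> (q - hproj q)"
  proof -
    have "q \<bullet> p uB = 0" using pS sub.harmonicD(2)[OF q] by auto
    moreover have "hproj q \<bullet> p uB = 0" using pV full.harmonicD(2)[OF harm_in] by auto
    ultimately show ?thesis by (simp add: inner_diff_left inner_diff_right inner_commute)
  qed
  finally have "\<bar>u \<bullet> q\<bar> \<le> norm (uB - p uB) * norm (q - hproj q)"
    by (simp add: Cauchy_Schwarz_ineq2)
  also have "\<dots> \<le> norm (uB - p uB) * (onorm (\<lambda>w. hproj w - p (hproj w)) * norm q)"
    using discrete_harmonic_range_part[OF q] onorm[OF harmonic_defect_bounded_linear, of q]
    by (intro mult_left_mono) auto
  finally show ?thesis .
qed

lemma discrete_harmonic_projection:
  assumes h: "h \<in> harmonic V d"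
  shows "norm (h - orth_proj (harmonic S d) h) \<le> norm (h - p h)"
proof -
  let ?k = "orth_proj (ker_on S d) h"
  note P = sub.sub_ker sub.closed_ker
  have k: "?k \<in> ker_on S d" by (rule orth_proj_mem[OF P])
  have "?k \<bullet> d x = 0" if x: "x \<in> S" for x
    using orth_proj_inner[OF P sub.range_in[OF x], of h] full.harmonicD(2)[OF h S_V[OF x]] by simp
  then have kh: "?k \<in> harmonic S d" using k by (auto simp: harmonic_def orthogonal_comp_iff)
  have "norm (h - orth_proj (harmonic S d) h) \<le> norm (h - ?k)"
    by (rule orth_proj_closest[OF sub.sub_harmonic sub.closed_harmonic kh])
  also have "\<dots> \<le> norm (h - p h)"
    by (rule orth_proj_closest[OF P p_ker[OF full.harmonicD(1)[OF h]]])
  finally show ?thesis .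
qed

lemma inner_le_graph_norm:
  assumes "norm x \<le> A" shows "x \<bullet> v \<le> A * graph_norm d v" "x \<bullet> d v \<le> A * graph_norm d v"
proof -
  have A: "0 \<le> A" using assms norm_ge_zero order_trans by blast
  have "norm x * norm v \<le> A * graph_norm d v" "norm x * norm (d v) \<le> A * graph_norm d v"
    using assms norm_le_graph_norm norm_image_le_graph_norm A by (auto intro!: mult_mono)
  then show "x \<bullet> v \<le> A * graph_norm d v" "x \<bullet> d v \<le> A * graph_norm d v"
    using norm_cauchy_schwarz[of x] order_trans by blast+
qed

lemma mixed_error:
  assumes M: "0 \<le> M" "\<And>y. y \<in> d ` V \<Longrightarrow> \<exists>v\<in>V. d v = y \<and> norm v \<le> M * norm y"
    and sol: "mixed_solution V d f \<sigma> u r" and dsol: "mixed_solution S d f \<sigma>h uh rh"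
  defines "c \<equiv> K * (M + 1)"
  defines "D \<equiv> (1 + c) * (c\<^sup>2 + 3 * c + 4) + (1 + c)\<^sup>2 + c + 4"
  shows "graph_norm d (\<sigma> - \<sigma>h) + graph_norm d (u - uh) + norm (r - rh)
    \<le> (D + 1) * (1 + K) * (best_error d S \<sigma> + best_error d S u + best_error d S r
        + onorm (\<lambda>w. hproj w - p (hproj w)) * best_error d S (orth_proj (d ` V) u))"
proof -
  define \<mu> where "\<mu> = onorm (\<lambda>w. hproj w - p (hproj w))"
  define q where "q = orth_proj (harmonic S d) r"
  define a b g where "a = graph_norm d (\<sigma> - p \<sigma>)" and "b = graph_norm d (u - p u)" and "g = norm (r - q)"
  define uB where "uB = orth_proj (d ` V) u"
  define e where "e = a + b + g + norm (uB - p uB) * \<mu>"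
  have \<mu>: "0 \<le> \<mu>" unfolding \<mu>_def by (rule onorm_pos_le[OF harmonic_defect_bounded_linear])
  have abg: "0 \<le> a" "0 \<le> b" "0 \<le> g" by (simp_all add: a_def b_def g_def)
  have c: "0 \<le> c" unfolding c_def using K_nonneg M(1) by simp
  have D: "0 \<le> D" unfolding D_def using c by simp
  have \<sigma>: "\<sigma> \<in> V" and u: "u \<in> V" and r: "r \<in> harmonic V d"
    and E1: "\<And>\<tau>. \<tau> \<in> V \<Longrightarrow> \<sigma> \<bullet> \<tau> - u \<bullet> d \<tau> = 0"
    and E2: "\<And>v. v \<in> V \<Longrightarrow> d \<sigma> \<bullet> v + d u \<bullet> d v + r \<bullet> v = f \<bullet> v"
    and E3: "\<And>q. q \<in> harmonic V d \<Longrightarrow> u \<bullet> q = 0"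
    using sol by (auto simp: mixed_solution_def)
  have \<sigma>h: "\<sigma>h \<in> S" and uh: "uh \<in> S" and rh: "rh \<in> harmonic S d"
    and H1: "\<And>\<tau>. \<tau> \<in> S \<Longrightarrow> \<sigma>h \<bullet> \<tau> - uh \<bullet> d \<tau> = 0"
    and H2: "\<And>v. v \<in> S \<Longrightarrow> d \<sigma>h \<bullet> v + d uh \<bullet> d v + rh \<bullet> v = f \<bullet> v"
    and H3: "\<And>q. q \<in> harmonic S d \<Longrightarrow> uh \<bullet> q = 0"
    using dsol by (auto simp: mixed_solution_def)
  have rV: "r \<in> V" using full.kerD(1)[OF full.harmonicD(1)[OF r]] .
  have q: "q \<in> harmonic S d"
    unfolding q_def by (rule orth_proj_mem[OF sub.sub_harmonic sub.closed_harmonic])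
  have p\<sigma>: "p \<sigma> \<in> S" and pu: "p u \<in> S" using p_in \<sigma> u by auto
  have mem: "\<sigma>h - p \<sigma> \<in> S" "uh - p u \<in> S" "rh - q \<in> harmonic S d"
    using \<sigma>h uh rh q p\<sigma> pu S_sub sub.sub_harmonic subspace_diff by blast+
  have dd: "d (\<sigma>h - p \<sigma>) = d \<sigma>h - d (p \<sigma>)" "d (uh - p u) = d uh - d (p u)"
    "d (\<sigma> - p \<sigma>) = d \<sigma> - d (p \<sigma>)" "d (u - p u) = d u - d (p u)"
    using \<sigma>h uh p\<sigma> pu \<sigma> u S_V by (simp_all add: lin_on_diff[OF full.lin])
  have na: "norm (\<sigma> - p \<sigma>) \<le> a" "norm (d (\<sigma> - p \<sigma>)) \<le> a"
    and nb: "norm (- (u - p u)) \<le> b" "norm (u - p u) \<le> b" "norm (d (u - p u)) \<le> b"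
    unfolding a_def b_def norm_minus_cancel
    by (rule norm_le_graph_norm norm_image_le_graph_norm)+
  have rest: "0 \<le> norm (uB - p uB) * \<mu>" using \<mu> by simp
  then have e: "0 \<le> e" using abg by (simp add: e_def)
  have stab: "graph_norm d (\<sigma>h - p \<sigma>) + graph_norm d (uh - p u) + norm (rh - q) \<le> D * e"
    unfolding D_def
  proof (rule sub.mixed_stability[OF c _ mem e])
    fix z assume "z \<in> S" "z \<in> (ker_on S d)\<^sup>\<bottom>"
    then show "norm z \<le> c * norm (d z)" unfolding c_def
      by (rule discrete_poincare[rotated]) (rule M(2))
  next
    fix t assume t: "t \<in> S"
    have "(\<sigma>h - p \<sigma>) \<bullet> t - (uh - p u) \<bullet> d t = (\<sigma> - p \<sigma>) \<bullet> t + (- (u - p u)) \<bullet> d t"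
      using E1[OF S_V[OF t]] H1[OF t] by (simp add: inner_diff_left)
    also have "\<dots> \<le> a * graph_norm d t + b * graph_norm d t"
      by (intro add_mono inner_le_graph_norm na nb)
    also have "\<dots> = (a + b) * graph_norm d t" by (simp add: distrib_right)
    also have "\<dots> \<le> e * graph_norm d t" using abg rest by (intro mult_right_mono) (auto simp: e_def)
    finally show "(\<sigma>h - p \<sigma>) \<bullet> t - (uh - p u) \<bullet> d t \<le> e * graph_norm d t" .
  next
    fix v assume v: "v \<in> S"
    have "d (\<sigma>h - p \<sigma>) \<bullet> v + d (uh - p u) \<bullet> d v + (rh - q) \<bullet> v
        = d (\<sigma> - p \<sigma>) \<bullet> v + d (u - p u) \<bullet> d v + (r - q) \<bullet> v"
      using E2[OF S_V[OF v]] H2[OF v] unfolding dd by (simp add: inner_diff_left)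
    also have "\<dots> \<le> a * graph_norm d v + b * graph_norm d v + g * graph_norm d v"
      by (intro add_mono inner_le_graph_norm na nb) (simp add: g_def)
    also have "\<dots> = (a + b + g) * graph_norm d v" by (simp add: distrib_right)
    also have "\<dots> \<le> e * graph_norm d v" using rest by (intro mult_right_mono) (auto simp: e_def)
    finally show "d (\<sigma>h - p \<sigma>) \<bullet> v + d (uh - p u) \<bullet> d v + (rh - q) \<bullet> v \<le> e * graph_norm d v" .
  next
    fix k assume k: "k \<in> harmonic S d"
    have "(uh - p u) \<bullet> k = (u - p u) \<bullet> k - u \<bullet> k" using H3[OF k] by (simp add: inner_diff_left)
    also have "\<dots> \<le> b * norm k + norm (uB - p uB) * (\<mu> * norm k)"
    proof -
      have "(u - p u) \<bullet> k \<le> b * norm k"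
        using norm_cauchy_schwarz[of "u - p u" k] mult_right_mono[OF nb(2) norm_ge_zero[of k]]
        by linarith
      then show ?thesis
        using harmonic_consistency[OF u E3 k] unfolding uB_def \<mu>_def by linarith
    qed
    also have "\<dots> = (b + norm (uB - p uB) * \<mu>) * norm k" by (simp add: algebra_simps)
    also have "\<dots> \<le> e * norm k" using abg by (intro mult_right_mono) (auto simp: e_def)
    finally show "(uh - p u) \<bullet> k \<le> e * norm k" .
  qed
  have "\<sigma> - \<sigma>h = (\<sigma> - p \<sigma>) - (\<sigma>h - p \<sigma>)" "u - uh = (u - p u) - (uh - p u)"
    "r - rh = (r - q) - (rh - q)" by simp_all
  moreover have "\<sigma> - p \<sigma> \<in> V" "u - p u \<in> V" "\<sigma>h - p \<sigma> \<in> V" "uh - p u \<in> V"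
    using \<sigma> u p\<sigma> pu S_V mem full.sub subspace_diff by blast+
  ultimately have "graph_norm d (\<sigma> - \<sigma>h) \<le> a + graph_norm d (\<sigma>h - p \<sigma>)"
    "graph_norm d (u - uh) \<le> b + graph_norm d (uh - p u)" "norm (r - rh) \<le> g + norm (rh - q)"
    unfolding a_def b_def g_def
    using graph_norm_triangle_diff[OF full.lin] norm_triangle_ineq4 by metis+
  then have "graph_norm d (\<sigma> - \<sigma>h) + graph_norm d (u - uh) + norm (r - rh) \<le> D * e + (a + b + g)"
    using stab by linarith
  also have "\<dots> \<le> (D + 1) * e" using rest by (simp add: e_def algebra_simps)
  also have "\<dots> \<le> (D + 1) * ((1 + K) * (best_error d S \<sigma> + best_error d S u + best_error d S r
        + \<mu> * best_error d S uB))"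
  proof (rule mult_left_mono)
    have uBV: "uB \<in> V"
      unfolding uB_def
      using orth_proj_mem[OF full.sub_range full.closed_range] full.range_ker full.kerD(1) by blast
    have "g \<le> norm (r - p r)" unfolding g_def q_def by (rule discrete_harmonic_projection[OF r])
    then have g: "g \<le> (1 + K) * best_error d S r"
      using norm_le_graph_norm[of "r - p r" d] quasi_optimal[OF rV] by linarith
    have "norm (uB - p uB) \<le> (1 + K) * best_error d S uB"
      using norm_le_graph_norm[of "uB - p uB" d] quasi_optimal[OF uBV] by linarith
    from mult_right_mono[OF this \<mu>]
    show "e \<le> (1 + K) * (best_error d S \<sigma> + best_error d S u + best_error d S r
        + \<mu> * best_error d S uB)"
      using g quasi_optimal[OF \<sigma>] quasi_optimal[OF u]
      unfolding e_def a_def b_def by (simp add: algebra_simps)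
  qed (use D in simp)
  finally show ?thesis unfolding \<mu>_def uB_def by (simp add: mult.assoc)
qed

end

theorem theorem4p4:
  fixes V :: "'w::{real_inner, complete_space} set"
    and d :: "'w \<Rightarrow> 'w"
    and Vh :: "'h \<Rightarrow> 'w set"
    and \<pi> :: "'h \<Rightarrow> 'w \<Rightarrow> 'w"
    and \<mu> :: "'h \<Rightarrow> real"
  assumes "closed_nilpotent_op V d"
    and "\<And>h. graph_closed_subspace V d (Vh h)"
    and "\<And>h. d ` Vh h \<subseteq> Vh h"
    and "\<And>h. projection_onto V (Vh h) (\<pi> h)"
    and "\<exists>K. \<forall>h. \<forall>v\<in>V. graph_norm d (\<pi> h v) \<le> K * graph_norm d v"
    and "\<And>h v. v \<in> V \<Longrightarrow> \<pi> h (d v) = d (\<pi> h v)"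
    and "\<And>h. \<mu> h = onorm (\<lambda>w. orth_proj (harmonic V d) w - \<pi> h (orth_proj (harmonic V d) w))"
  shows "\<exists>C>0. \<forall>f h \<sigma> u p \<sigma>h uh ph.
           mixed_solution V d f \<sigma> u p \<longrightarrow> mixed_solution (Vh h) d f \<sigma>h uh ph \<longrightarrow>
           graph_norm d (\<sigma> - \<sigma>h) + graph_norm d (u - uh) + norm (p - ph)
             \<le> C * (best_error d (Vh h) \<sigma> + best_error d (Vh h) u + best_error d (Vh h) p
                    + \<mu> h * best_error d (Vh h) (orth_proj (d ` V) u))"
proof -
  have op: "closed_op V d" and cl: "closed (d ` V)" and nil: "d ` V \<subseteq> ker_on V d"
    using assms(1) by (auto simp: closed_nilpotent_op_def nilpotent_op_def)
  interpret full: hilbert_complex V d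
    using op cl nil closed_ker_on[OF op] by unfold_locales (simp_all add: closed_op_def)
  obtain M where M: "M > 0" "\<And>y. y \<in> d ` V \<Longrightarrow> \<exists>v\<in>V. d v = y \<and> norm v \<le> M * norm y"
    using closed_range_bounded_preimage[OF op cl] by blast
  obtain K0 where K0: "\<And>h v. v \<in> V \<Longrightarrow> graph_norm d (\<pi> h v) \<le> K0 * graph_norm d v"
    using assms(5) by blast
  define K where "K = max K0 0"
  have K: "graph_norm d (\<pi> h v) \<le> K * graph_norm d v" if "v \<in> V" for h v
    using K0[OF that, of h] mult_right_mono[of K0 K "graph_norm d v"] by (simp add: K_def)
  have S: "hilbert_subcomplex V d (Vh h) (\<pi> h) K" for h
    by unfold_locales (use assms K in \<open>auto simp: K_def\<close>)
  define c where "c = K * (M + 1)"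
  define C where "C = ((1 + c) * (c\<^sup>2 + 3 * c + 4) + (1 + c)\<^sup>2 + c + 4 + 1) * (1 + K)"
  have "0 \<le> K" "0 \<le> c" using M(1) by (auto simp: K_def c_def)
  then have "0 \<le> (1 + c) * (c\<^sup>2 + 3 * c + 4) + (1 + c)\<^sup>2 + c + 4"
    by (intro add_nonneg_nonneg mult_nonneg_nonneg) auto
  then have "0 < C" unfolding C_def using \<open>0 \<le> K\<close> by (intro mult_pos_pos) linarith+
  moreover have "graph_norm d (\<sigma> - \<sigma>h) + graph_norm d (u - uh) + norm (p - ph)
      \<le> C * (best_error d (Vh h) \<sigma> + best_error d (Vh h) u + best_error d (Vh h) p
            + \<mu> h * best_error d (Vh h) (orth_proj (d ` V) u))"
    if "mixed_solution V d f \<sigma> u p" "mixed_solution (Vh h) d f \<sigma>h uh ph" for f h \<sigma> u p \<sigma>h uh ph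
    unfolding C_def c_def assms(7)
    by (rule hilbert_subcomplex.mixed_error[OF S less_imp_le[OF M(1)] M(2) that])
  ultimately show ?thesis by blast
qed

end
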